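(* Let $X$ be a real random variable with finite first and second moments, with mean $\mu = \mathbb{E}[X]$ and variance $\operatorname{Var}(X)$. Let $a > 0$ and let $U$ be a random variable independent of $X$ that is uniformly distributed over $[-\tfrac12 a, \tfrac12 a]$. Then $$\mathbb{P}(|X + U - \mu| \geq a) \leq \frac{1}{2}\cdot\frac{\operatorname{Var}(X)}{a^2}.$$ *)

theory Defs
  imports "HOL-Probability.Probability"
begin

end

theory Submission
  imports Defs
begin

text \<open>
  Condition on the value of \<open>X\<close>. If \<open>y\<close> is the deviation of \<open>X\<close> from its mean, then
  \<open>\<bar>y + U\<bar> \<ge> a\<close> forces \<open>U\<close> into \<open>[a - y, a/2]\<close> if \<open>y \<ge> 0\<close>, and into the mirror image
  \<open>[- a/2, - a - y]\<close> if \<open>y < 0\<close>. So the conditional probability is at most \<open>t - 1/2\<close> with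
  \<open>t = \<bar>y\<bar>/a\<close>, or zero if \<open>t < 1/2\<close>.
  Since \<open>(t - 1)\<^sup>2 \<ge> 0\<close>, this is at most \<open>t\<^sup>2/2\<close>: the parabola touches the linear tail at \<open>t = 1\<close>,
  where Chebyshev's inequality has to allow for a probability of \<open>1\<close> and the smoothing by \<open>U\<close>
  reduces it to \<open>1/2\<close>.
  Averaging the bound \<open>y\<^sup>2/(2a\<^sup>2)\<close> over the law of \<open>X\<close>, which independence permits by
  Tonelli's theorem, yields the variance.
\<close>

text \<open>
  Only one of the two inequalities \<open>y + u \<ge> a\<close> and \<open>y + u \<le> -a\<close> is possible for \<open>\<bar>u\<bar> \<le> a/2\<close>,
  namely the one on the side of \<open>y\<close>.
\<close>
lemma uniform_measure_shift_tail_le: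
  fixes a y :: real
  assumes "a > 0"
  shows "emeasure (uniform_measure lborel {- (1/2) * a .. (1/2) * a}) {u. \<bar>y + u\<bar> \<ge> a}
         \<le> ennreal (y\<^sup>2 / (2 * a\<^sup>2))"
proof -
  let ?I = "{- (1/2) * a .. (1/2) * a}" and ?B = "{u. \<bar>y + u\<bar> \<ge> a}"
  define J where "J = (if y \<ge> 0 then {a - y .. a/2} else {- (a/2) .. - a - y})"
  have "emeasure lborel (?I \<inter> ?B) \<le> emeasure lborel J"
    using assms by (intro emeasure_mono) (auto simp: J_def)
  also have "\<dots> = ennreal (\<bar>y\<bar> - a/2)"
    by (auto simp: J_def emeasure_lborel_Icc_eq ennreal_neg)
  also have "\<dots> \<le> ennreal (y\<^sup>2 / (2 * a))"
  proof (rule ennreal_leI)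
    have "0 \<le> (\<bar>y\<bar> - a)\<^sup>2" by simp
    then show "\<bar>y\<bar> - a/2 \<le> y\<^sup>2 / (2 * a)"
      using assms by (simp add: power2_diff field_simps power2_eq_square)
  qed
  finally have *: "emeasure lborel (?I \<inter> ?B) \<le> ennreal (y\<^sup>2 / (2 * a))" .
  have "emeasure (uniform_measure lborel ?I) ?B = emeasure lborel (?I \<inter> ?B) / ennreal a"
    using assms by (subst emeasure_uniform_measure) auto
  also have "\<dots> \<le> ennreal (y\<^sup>2 / (2 * a)) / ennreal a"
    by (rule divide_right_mono_ennreal[OF *])
  also have "\<dots> = ennreal (y\<^sup>2 / (2 * a\<^sup>2))"
    using assms by (simp add: divide_ennreal power2_eq_square mult.assoc)
  finally show ?thesis .
qed

text \<open>
  By independence the joint law is the product of the marginals, so an event about \<open>(X, Y)\<close> can be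
  measured slice by slice, each slice being weighed by the unconditional law of \<open>Y\<close>.
\<close>
lemma (in prob_space) emeasure_indep_var_eq_nn_integral:
  assumes "indep_var S X T Y" and "A \<in> sets (S \<Otimes>\<^sub>M T)"
  shows "emeasure M {\<omega> \<in> space M. (X \<omega>, Y \<omega>) \<in> A}
         = (\<integral>\<^sup>+ \<omega>. emeasure (distr M T Y) (Pair (X \<omega>) -` A) \<partial>M)"
proof -
  have X[measurable]: "X \<in> measurable M S" and Y[measurable]: "Y \<in> measurable M T"
    and prod: "distr M S X \<Otimes>\<^sub>M distr M T Y = distr M (S \<Otimes>\<^sub>M T) (\<lambda>\<omega>. (X \<omega>, Y \<omega>))"
    using assms(1) unfolding indep_var_distribution_eq by auto
  interpret DX: prob_space "distr M S X" by (rule prob_space_distr[OF X])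
  interpret DY: prob_space "distr M T Y" by (rule prob_space_distr[OF Y])
  have A': "A \<in> sets (S \<Otimes>\<^sub>M distr M T Y)" "A \<in> sets (distr M S X \<Otimes>\<^sub>M distr M T Y)"
    using assms(2) by (simp_all cong: sets_pair_measure_cong)
  have "emeasure M {\<omega> \<in> space M. (X \<omega>, Y \<omega>) \<in> A}
        = emeasure (distr M S X \<Otimes>\<^sub>M distr M T Y) A"
    unfolding prod using assms(2)
    by (subst emeasure_distr) (auto intro!: arg_cong[where f = "emeasure M"])
  also have "\<dots> = (\<integral>\<^sup>+ x. emeasure (distr M T Y) (Pair x -` A) \<partial>distr M S X)"
    by (rule DY.emeasure_pair_measure_alt[OF A'(2)])
  also have "\<dots> = (\<integral>\<^sup>+ \<omega>. emeasure (distr M T Y) (Pair (X \<omega>) -` A) \<partial>M)"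
    using DY.measurable_emeasure_Pair[OF A'(1)] by (intro nn_integral_distr) simp_all
  finally show ?thesis .
qed

theorem lemma9:
  fixes M :: "'a measure" and X U :: "'a \<Rightarrow> real" and a \<mu> :: real
  assumes "prob_space M"
    and "X \<in> borel_measurable M"
    and "integrable M X"
    and "integrable M (\<lambda>\<omega>. (X \<omega>)\<^sup>2)"
    and "\<mu> = prob_space.expectation M X"
    and "a > 0"
    and "prob_space.indep_var M borel X borel U"
    and "distr M borel U = uniform_measure lborel {- (1/2) * a .. (1/2) * a}"
  shows "measure M {\<omega> \<in> space M. \<bar>X \<omega> + U \<omega> - \<mu>\<bar> \<ge> a}
         \<le> 1/2 * (prob_space.variance M X / a\<^sup>2)"
proof -
  interpret prob_space M by fact
  let ?E = "{\<omega> \<in> space M. \<bar>X \<omega> + U \<omega> - \<mu>\<bar> \<ge> a}"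
  let ?A = "{p :: real \<times> real. \<bar>fst p + snd p - \<mu>\<bar> \<ge> a}"
  have A: "?A \<in> sets (borel \<Otimes>\<^sub>M borel)"
  proof -
    have "{p \<in> space (borel \<Otimes>\<^sub>M borel). \<bar>fst p + snd p - \<mu>\<bar> \<ge> a} \<in> sets (borel \<Otimes>\<^sub>M borel)"
      by measurable
    then show ?thesis by (simp add: space_pair_measure)
  qed
  have slice: "Pair x -` ?A = {u. \<bar>(x - \<mu>) + u\<bar> \<ge> a}" for x
    by (auto simp: algebra_simps)
  have int: "integrable M (\<lambda>\<omega>. (X \<omega> - \<mu>)\<^sup>2)"
    using assms(3,4) by (simp add: power2_diff)
  have "emeasure M ?E = (\<integral>\<^sup>+ \<omega>. emeasure (distr M borel U) (Pair (X \<omega>) -` ?A) \<partial>M)"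
    using emeasure_indep_var_eq_nn_integral[OF assms(7) A] by simp
  also have "\<dots> \<le> (\<integral>\<^sup>+ \<omega>. ennreal ((X \<omega> - \<mu>)\<^sup>2 / (2 * a\<^sup>2)) \<partial>M)"
    unfolding slice assms(8) by (intro nn_integral_mono uniform_measure_shift_tail_le assms(6))
  also have "\<dots> = ennreal (\<integral>\<omega>. (X \<omega> - \<mu>)\<^sup>2 / (2 * a\<^sup>2) \<partial>M)"
    using int by (intro nn_integral_eq_integral) auto
  also have "(\<integral>\<omega>. (X \<omega> - \<mu>)\<^sup>2 / (2 * a\<^sup>2) \<partial>M) = 1/2 * (variance X / a\<^sup>2)"
    unfolding assms(5) by simp
  finally have "ennreal (prob ?E) \<le> ennreal (1/2 * (variance X / a\<^sup>2))"
    by (simp add: emeasure_eq_measure)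
  then show ?thesis
    by (subst (asm) ennreal_le_iff) (auto intro!: divide_nonneg_nonneg integral_nonneg)
qed

end
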